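(* Let $A$ be a $d\times d$ Metzler matrix with $\eta(A)<0$, and consider the problem $$\|X-A\|_\infty\to\min\quad\text{subject to}\quad \eta(X)=0$$ over real $d\times d$ matrices $X$. The optimal value $\tau_*$ of this problem is the reciprocal of the biggest component of the vector $-A^{-1}\boldsymbol e$. Let $k$ be the index of that component. Then the optimal solution is the matrix $$X=A+\tau_*E_k.$$
   Context: A matrix is Metzler if its off-diagonal entries are non-negative. $\eta(X)$ is the spectral abscissa, the largest real part of the eigenvalues of $X$. $\|X\|_\infty=\max_i\sum_j|x_{ij}|$. $\boldsymbol e$ is the vector of all ones, and $E_k=\boldsymbol e\boldsymbol e_k^T$ is the matrix whose $k$-th column consists of ones and whose other entries are zero. A Metzler matrix with $\eta(A)<0$ is invertible. "The optimal solution" means that the matrix is feasible and attains the minimum. *)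

theory Defs
  imports
    "Jordan_Normal_Form.Gauss_Jordan_Elimination"
    "Jordan_Normal_Form.Spectral_Radius"
begin

text \<open>Matrix and vector indices start at 0 throughout.\<close>

definition metzler :: "real mat \<Rightarrow> bool" where
  "metzler A \<longleftrightarrow> (\<forall>i < dim_row A. \<forall>j < dim_col A. i \<noteq> j \<longrightarrow> 0 \<le> A $$ (i, j))"

text \<open>The spectrum is taken over the complex numbers. It is finite and nonempty for square
  matrices of positive dimension; in dimension 0 the maximum is unspecified.\<close>

definition spectral_abscissa :: "real mat \<Rightarrow> real" where
  "spectral_abscissa X = Max (Re ` spectrum (map_mat complex_of_real X))"

definition inf_norm_mat :: "real mat \<Rightarrow> real" where
  "inf_norm_mat X = Max ((\<lambda>i. \<Sum>j < dim_col X. \<bar>X $$ (i, j)\<bar>) ` {..< dim_row X})"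

definition ones_vec :: "nat \<Rightarrow> real vec" where
  "ones_vec d = vec d (\<lambda>_. 1)"

definition ones_col_mat :: "nat \<Rightarrow> nat \<Rightarrow> real mat" where
  "ones_col_mat d k = mat d d (\<lambda>(i, j). if j = k then 1 else 0)"

definition feasible_set :: "nat \<Rightarrow> real mat set" where
  "feasible_set d = {X \<in> carrier_mat d d. spectral_abscissa X = 0}"

text \<open>The feasible set is nonempty for positive \<open>d\<close> (it contains the zero matrix) and the
  objective is bounded below by 0, so the infimum below is a genuine one. That it is attained
  is expressed by \<open>is_optimal_solution\<close>.\<close>

definition optimal_value :: "nat \<Rightarrow> real mat \<Rightarrow> real" where
  "optimal_value d A = (INF X \<in> feasible_set d. inf_norm_mat (X - A))"

definition is_optimal_solution :: "nat \<Rightarrow> real mat \<Rightarrow> real mat \<Rightarrow> bool" where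
  "is_optimal_solution d A X \<longleftrightarrow>
     X \<in> feasible_set d \<and> (\<forall>Y \<in> feasible_set d. inf_norm_mat (X - A) \<le> inf_norm_mat (Y - A))"

text \<open>The vector \<open>- A\<^sup>-\<^sup>1 e\<close>. The function \<open>mat_inverse\<close> returns \<open>Some\<close> of the inverse
  precisely when the square matrix is invertible, which is the case for Metzler matrices with
  negative spectral abscissa.\<close>

definition neg_inv_ones :: "nat \<Rightarrow> real mat \<Rightarrow> real vec" where
  "neg_inv_ones d A = - (the (mat_inverse A) *\<^sub>v ones_vec d)"

end

theory Submission
  imports Defs
begin

text \<open>Let \<open>u = - A\<^sup>-\<^sup>1 e\<close>, which is positive by stability of \<open>A\<close>. If \<open>Y\<close> is feasible,
  take an eigenvector \<open>x\<close> of \<open>Y\<close> to an eigenvalue \<open>\<mu>\<close> on the imaginary axis, and let \<open>m\<close> be the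
  largest of the ratios \<open>|x\<^sub>i| / u\<^sub>i\<close>. In a row \<open>i\<close> where it is attained, \<open>|\<mu> - a\<^sub>i\<^sub>i| \<ge> Re \<mu> - a\<^sub>i\<^sub>i\<close>
  and the Metzler property give \<open>0 \<le> (A |x|)\<^sub>i + (|Y - A| |x|)\<^sub>i \<le> - m + \<parallel>Y - A\<parallel> m max u\<close>, the lower
  bound. The matrix \<open>A + \<tau> E\<^sub>k\<close> annihilates \<open>u\<close> when \<open>\<tau> u\<^sub>k = 1\<close>, and the same estimate in weights
  \<open>u\<close> shows that a Metzler matrix with a positive kernel vector has spectral abscissa 0.\<close>

section \<open>Matrix-vector entries and the spectral abscissa\<close>

lemma mult_mat_vec_nth:
  assumes "B \<in> carrier_mat d d" "v \<in> carrier_vec d" "i < d"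
  shows "(B *\<^sub>v v) $ i = (\<Sum>j<d. B $$ (i, j) * v $ j)"
  using assms by (auto simp: scalar_prod_def atLeast0LessThan)

lemma smult_one_mult_mat_vec:
  fixes w :: "'a::comm_ring_1 vec"
  assumes "w \<in> carrier_vec d"
  shows "(a \<cdot>\<^sub>m 1\<^sub>m d) *\<^sub>v w = a \<cdot>\<^sub>v w"
proof (rule eq_vecI)
  fix i assume "i < dim_vec (a \<cdot>\<^sub>v w)"
  then have i: "i < d" using assms by simp
  have "((a \<cdot>\<^sub>m 1\<^sub>m d) *\<^sub>v w) $ i = (\<Sum>j<d. (a \<cdot>\<^sub>m 1\<^sub>m d) $$ (i, j) * w $ j)"
    using assms i by (intro mult_mat_vec_nth) auto
  also have "\<dots> = (\<Sum>j<d. if j = i then a * w $ i else 0)"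
    using i by (intro sum.cong) auto
  finally show "((a \<cdot>\<^sub>m 1\<^sub>m d) *\<^sub>v w) $ i = (a \<cdot>\<^sub>v w) $ i"
    using i assms by simp
qed (use assms in simp)

lemma Re_le_spectral_abscissa:
  assumes "X \<in> carrier_mat d d" "\<mu> \<in> spectrum (map_mat complex_of_real X)"
  shows "Re \<mu> \<le> spectral_abscissa X"
  unfolding spectral_abscissa_def
  using assms card_finite_spectrum(1)[of "map_mat complex_of_real X" d] by (intro Max_ge) auto

lemma spectral_abscissa_attained:
  assumes "X \<in> carrier_mat d d" "d > 0"
  obtains \<mu> where "\<mu> \<in> spectrum (map_mat complex_of_real X)" "Re \<mu> = spectral_abscissa X"
proof -
  let ?S = "spectrum (map_mat complex_of_real X)"
  have "finite ?S" "?S \<noteq> {}"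
    using assms card_finite_spectrum(1)[of "map_mat complex_of_real X" d]
      spectrum_non_empty[of "map_mat complex_of_real X" d] by auto
  then have "spectral_abscissa X \<in> Re ` ?S"
    unfolding spectral_abscissa_def by (intro Max_in) auto
  then show ?thesis using that by auto
qed

text \<open>A real eigenvalue survives the passage to the complex matrix. The contrapositive later
  rules out eigenvalues \<open>s >= 0\<close> of a stable matrix.\<close>

lemma eigenvalue_le_spectral_abscissa:
  assumes "X \<in> carrier_mat d d" "eigenvalue X s"
  shows "s \<le> spectral_abscissa X"
proof -
  have "eigenvalue (map_mat complex_of_real X) (complex_of_real s)"
    using of_real_hom.eigenvalue_hom[OF assms] .
  then show ?thesis
    using Re_le_spectral_abscissa[OF assms(1), of "complex_of_real s"] by (simp add: spectrum_def)
qed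

section \<open>Weighted maximum estimates for Metzler matrices\<close>

text \<open>Row \<open>i\<close> is one where the ratio \<open>z j / u j\<close> is largest.
  Replacing \<open>z j\<close> by \<open>m * u j\<close> can only increase the off-diagonal terms,
  and it leaves the diagonal term unchanged, so the sign of the diagonal entry does not
  matter.\<close>

lemma metzler_weighted_max:
  fixes u z :: "nat \<Rightarrow> real"
  assumes A: "A \<in> carrier_mat d d" "metzler A" and "d > 0"
    and u: "\<And>j. j < d \<Longrightarrow> 0 < u j"
  obtains i m where "i < d" "z i = m * u i" "\<forall>j<d. z j \<le> m * u j"
    "(\<Sum>j<d. A $$ (i, j) * z j) \<le> m * (\<Sum>j<d. A $$ (i, j) * u j)"
proof -
  define m where "m = Max ((\<lambda>j. z j / u j) ` {..<d})"
  have "m \<in> (\<lambda>j. z j / u j) ` {..<d}"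
    unfolding m_def using \<open>d > 0\<close> by (intro Max_in) auto
  then obtain i where i: "i < d" "m = z i / u i" by auto
  have zi: "z i = m * u i" using i u[OF i(1)] by auto
  have le: "z j \<le> m * u j" if "j < d" for j
  proof -
    have "z j / u j \<le> m" unfolding m_def using that by (intro Max_ge) auto
    then show ?thesis using u[OF that] by (simp add: field_simps)
  qed
  have "A $$ (i, j) * z j \<le> A $$ (i, j) * (m * u j)" if "j < d" for j
  proof (cases "j = i")
    case False
    then have "0 \<le> A $$ (i, j)" using A i that by (auto simp: metzler_def)
    then show ?thesis using le[OF that] by (rule mult_left_mono[rotated])
  qed (simp add: zi)
  then have "(\<Sum>j<d. A $$ (i, j) * z j) \<le> (\<Sum>j<d. A $$ (i, j) * (m * u j))"
    by (intro sum_mono) auto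
  also have "\<dots> = m * (\<Sum>j<d. A $$ (i, j) * u j)"
    by (simp add: sum_distrib_left mult_ac)
  finally show ?thesis using that i(1) zi le by blast
qed

text \<open>Split \<open>Y = A + (Y - A)\<close>, isolate the diagonal entry of \<open>A\<close> in
  row \<open>i\<close> and take norms. Off the diagonal the entries of \<open>A\<close> equal their
  absolute values; on the diagonal, bounding the modulus below by the real part lets the entry
  return with its own sign.\<close>

lemma metzler_perturbed_eigenvalue_bound:
  assumes A: "A \<in> carrier_mat d d" "metzler A" and Y: "Y \<in> carrier_mat d d"
    and x: "map_mat complex_of_real Y *\<^sub>v x = \<mu> \<cdot>\<^sub>v x" "x \<in> carrier_vec d" and i: "i < d"
  shows "Re \<mu> * norm (x $ i) \<le> (\<Sum>j<d. A $$ (i, j) * norm (x $ j))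
    + (\<Sum>j<d. \<bar>(Y - A) $$ (i, j)\<bar> * norm (x $ j))"
proof -
  let ?a = "\<lambda>j. complex_of_real (A $$ (i, j))"
  let ?D = "\<lambda>j. complex_of_real ((Y - A) $$ (i, j))"
  have "\<mu> * x $ i = (map_mat complex_of_real Y *\<^sub>v x) $ i"
    using x i by simp
  also have "\<dots> = (\<Sum>j<d. map_mat complex_of_real Y $$ (i, j) * x $ j)"
    by (rule mult_mat_vec_nth) (use Y x i in auto)
  also have "\<dots> = (\<Sum>j<d. ?a j * x $ j + ?D j * x $ j)"
    using A Y i by (intro sum.cong) (auto simp: algebra_simps)
  also have "\<dots> = ?a i * x $ i + (\<Sum>j\<in>{..<d} - {i}. ?a j * x $ j) + (\<Sum>j<d. ?D j * x $ j)"
    using i by (simp add: sum.distrib sum.remove[of "{..<d}" i "\<lambda>j. ?a j * x $ j"])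
  finally have "(\<mu> - ?a i) * x $ i
      = (\<Sum>j\<in>{..<d} - {i}. ?a j * x $ j) + (\<Sum>j<d. ?D j * x $ j)"
    by (simp add: algebra_simps)
  then have "norm (\<mu> - ?a i) * norm (x $ i)
      = norm ((\<Sum>j\<in>{..<d} - {i}. ?a j * x $ j) + (\<Sum>j<d. ?D j * x $ j))"
    by (metis norm_mult)
  also have "\<dots> \<le> (\<Sum>j\<in>{..<d} - {i}. norm (?a j * x $ j)) + (\<Sum>j<d. norm (?D j * x $ j))"
    by (intro norm_triangle_mono norm_sum)
  also have "(\<Sum>j\<in>{..<d} - {i}. norm (?a j * x $ j))
      = (\<Sum>j\<in>{..<d} - {i}. A $$ (i, j) * norm (x $ j))"
    using A i by (intro sum.cong) (auto simp: metzler_def norm_mult)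
  also have "(\<Sum>j<d. norm (?D j * x $ j)) = (\<Sum>j<d. \<bar>(Y - A) $$ (i, j)\<bar> * norm (x $ j))"
    by (simp add: norm_mult del: index_minus_mat)
  finally have "norm (\<mu> - ?a i) * norm (x $ i) \<le> (\<Sum>j\<in>{..<d} - {i}. A $$ (i, j) * norm (x $ j))
      + (\<Sum>j<d. \<bar>(Y - A) $$ (i, j)\<bar> * norm (x $ j))" .
  moreover have "(Re \<mu> - A $$ (i, i)) * norm (x $ i) \<le> norm (\<mu> - ?a i) * norm (x $ i)"
    using complex_Re_le_cmod[of "\<mu> - ?a i"] by (intro mult_right_mono) auto
  moreover have "(\<Sum>j<d. A $$ (i, j) * norm (x $ j))
      = A $$ (i, i) * norm (x $ i) + (\<Sum>j\<in>{..<d} - {i}. A $$ (i, j) * norm (x $ j))"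
    using i by (intro sum.remove) auto
  ultimately show ?thesis by (simp only: left_diff_distrib)
qed

lemma spectrum_eigenvectorE:
  assumes "M \<in> carrier_mat d d" "\<mu> \<in> spectrum M"
  obtains x j where "x \<in> carrier_vec d" "M *\<^sub>v x = \<mu> \<cdot>\<^sub>v x" "j < d" "x $ j \<noteq> 0"
proof -
  obtain x where x: "x \<in> carrier_vec d" "x \<noteq> 0\<^sub>v d" "M *\<^sub>v x = \<mu> \<cdot>\<^sub>v x"
    using assms by (auto simp: spectrum_def eigenvalue_def eigenvector_def)
  then have "\<exists>j<d. x $ j \<noteq> 0" by (metis carrier_vecD eq_vecI index_zero_vec)
  then show ?thesis using that x by blast
qed

lemma metzler_positive_kernel_abscissa:
  assumes X: "X \<in> carrier_mat d d" "metzler X" and "d > 0"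
    and u: "u \<in> carrier_vec d" "\<And>j. j < d \<Longrightarrow> 0 < u $ j"
    and Xu: "X *\<^sub>v u = 0\<^sub>v d"
  shows "spectral_abscissa X = 0"
proof (rule antisym)
  have "u \<noteq> 0\<^sub>v d" using u(2)[OF \<open>d > 0\<close>] \<open>d > 0\<close> by auto
  then have "eigenvalue X 0"
    using X u Xu by (auto simp: eigenvalue_def eigenvector_def intro!: exI[of _ u])
  then show "0 \<le> spectral_abscissa X"
    using X(1) eigenvalue_le_spectral_abscissa by blast
  obtain \<mu> where l: "\<mu> \<in> spectrum (map_mat complex_of_real X)" "Re \<mu> = spectral_abscissa X"
    using spectral_abscissa_attained X(1) \<open>d > 0\<close> .
  have C: "map_mat complex_of_real X \<in> carrier_mat d d" using X(1) by simp
  obtain x k where x: "x \<in> carrier_vec d" "map_mat complex_of_real X *\<^sub>v x = \<mu> \<cdot>\<^sub>v x"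
    and k: "k < d" "x $ k \<noteq> 0"
    by (rule spectrum_eigenvectorE[OF C l(1)])
  obtain i m where i: "i < d" "norm (x $ i) = m * u $ i"
      and le: "\<forall>j<d. norm (x $ j) \<le> m * u $ j"
      and sum: "(\<Sum>j<d. X $$ (i, j) * norm (x $ j)) \<le> m * (\<Sum>j<d. X $$ (i, j) * u $ j)"
    by (rule metzler_weighted_max[where u = "\<lambda>j. u $ j" and z = "\<lambda>j. norm (x $ j)",
          OF X \<open>d > 0\<close> u(2)])
  \<comment> \<open>A nonzero component of the eigenvector makes the maximal ratio positive, so
    \<open>x $ i\<close> is nonzero in the chosen row.\<close>
  have "0 < m * u $ k" using le[rule_format, OF k(1)] k(2) by (metis order_less_le_trans zero_less_norm_iff)
  then have m: "0 < m" using u(2)[OF k(1)] by (simp add: zero_less_mult_iff)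
  have "(\<Sum>j<d. X $$ (i, j) * u $ j) = (X *\<^sub>v u) $ i"
    using mult_mat_vec_nth[OF X(1) u(1) i(1)] by simp
  then have "(\<Sum>j<d. X $$ (i, j) * u $ j) = 0"
    using Xu i by simp
  \<comment> \<open>The perturbation bound is applied with \<open>Y = A = X\<close>, so its second
    sum vanishes.\<close>
  moreover have "Re \<mu> * norm (x $ i) \<le> (\<Sum>j<d. X $$ (i, j) * norm (x $ j))
      + (\<Sum>j<d. \<bar>(X - X) $$ (i, j)\<bar> * norm (x $ j))"
    using metzler_perturbed_eigenvalue_bound[OF X X(1) x(2,1) i(1)] .
  moreover have "(\<Sum>j<d. \<bar>(X - X) $$ (i, j)\<bar> * norm (x $ j)) = 0"
    using X i by (intro sum.neutral) auto
  ultimately have "Re \<mu> * norm (x $ i) \<le> 0" using sum by simp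
  moreover have "0 < norm (x $ i)" using i m u(2) by simp
  ultimately show "spectral_abscissa X \<le> 0" using l by (simp add: mult_le_0_iff)
qed

section \<open>Lower bound for the distance to the feasible set\<close>

lemma row_sum_le_inf_norm_mat:
  assumes "D \<in> carrier_mat d d" "i < d"
  shows "(\<Sum>j<d. \<bar>D $$ (i, j)\<bar>) \<le> inf_norm_mat D"
  unfolding inf_norm_mat_def using assms by (intro Max_ge) auto

lemma inf_norm_lower_bound:
  assumes A: "A \<in> carrier_mat d d" "metzler A" and "d > 0"
    and u: "u \<in> carrier_vec d" "\<And>j. j < d \<Longrightarrow> 0 < u $ j" "\<And>j. j < d \<Longrightarrow> u $ j \<le> c"
    and Au: "A *\<^sub>v u = - ones_vec d"
    and Y: "Y \<in> feasible_set d"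
  shows "1 / c \<le> inf_norm_mat (Y - A)"
proof -
  have Yc: "Y \<in> carrier_mat d d" and "spectral_abscissa Y = 0"
    using Y by (auto simp: feasible_set_def)
  then obtain \<mu> where l: "\<mu> \<in> spectrum (map_mat complex_of_real Y)" "Re \<mu> = 0"
    using spectral_abscissa_attained[OF Yc \<open>d > 0\<close>] by metis
  have C: "map_mat complex_of_real Y \<in> carrier_mat d d" using Yc by simp
  obtain x k where x: "x \<in> carrier_vec d" "map_mat complex_of_real Y *\<^sub>v x = \<mu> \<cdot>\<^sub>v x"
    and k: "k < d" "x $ k \<noteq> 0"
    by (rule spectrum_eigenvectorE[OF C l(1)])
  obtain i m where i: "i < d" "norm (x $ i) = m * u $ i"
      and le: "\<forall>j<d. norm (x $ j) \<le> m * u $ j"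
      and sum: "(\<Sum>j<d. A $$ (i, j) * norm (x $ j)) \<le> m * (\<Sum>j<d. A $$ (i, j) * u $ j)"
    by (rule metzler_weighted_max[where u = "\<lambda>j. u $ j" and z = "\<lambda>j. norm (x $ j)",
          OF A \<open>d > 0\<close> u(2)])
  have "0 < m * u $ k" using le[rule_format, OF k(1)] k(2) by (metis order_less_le_trans zero_less_norm_iff)
  then have m: "0 < m" using u(2)[OF k(1)] by (simp add: zero_less_mult_iff)
  have c: "0 < c" using u(2,3)[OF \<open>d > 0\<close>] by linarith
  have "(\<Sum>j<d. A $$ (i, j) * u $ j) = (A *\<^sub>v u) $ i"
    using mult_mat_vec_nth[OF A(1) u(1) i(1)] by simp
  then have "(\<Sum>j<d. A $$ (i, j) * u $ j) = -1"
    using Au i by (simp add: ones_vec_def)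
  \<comment> \<open>The left side of the perturbation bound vanishes because
    \<open>Re \<mu> = 0\<close>, while the sum over \<open>A\<close> is at most
    \<open>- m\<close>.\<close>
  then have "m \<le> (\<Sum>j<d. \<bar>(Y - A) $$ (i, j)\<bar> * norm (x $ j))"
    using metzler_perturbed_eigenvalue_bound[OF A Yc x(2,1) i(1)] sum l(2) by simp
  also have "\<dots> \<le> (\<Sum>j<d. \<bar>(Y - A) $$ (i, j)\<bar> * (m * c))"
  proof (intro sum_mono mult_left_mono)
    fix j assume "j \<in> {..<d}"
    then have "norm (x $ j) \<le> m * u $ j" "m * u $ j \<le> m * c" using le u(3) m by auto
    then show "norm (x $ j) \<le> m * c" by linarith
  qed simp
  also have "\<dots> = (\<Sum>j<d. \<bar>(Y - A) $$ (i, j)\<bar>) * (m * c)"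
    by (simp add: sum_distrib_right)
  also have "\<dots> \<le> inf_norm_mat (Y - A) * (m * c)"
    using row_sum_le_inf_norm_mat[OF minus_carrier_mat[OF A(1)] i(1), of Y] m c
    by (intro mult_right_mono) auto
  finally have "m * 1 \<le> m * (inf_norm_mat (Y - A) * c)" by (simp add: mult_ac)
  then have "1 \<le> inf_norm_mat (Y - A) * c" using m by (metis mult_le_cancel_left_pos)
  then show ?thesis using c by (simp add: field_simps)
qed

section \<open>Positivity of the solution of \<open>A u = - e\<close>\<close>

lemma continuous_on_Min_image:
  fixes f :: "'i \<Rightarrow> 'a::topological_space \<Rightarrow> 'b::linorder_topology"
  assumes "finite I" "I \<noteq> {}" "\<And>i. i \<in> I \<Longrightarrow> continuous_on S (f i)"
  shows "continuous_on S (\<lambda>x. Min ((\<lambda>i. f i x) ` I))"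
  using assms by (induction I rule: finite_ne_induct) (auto intro: continuous_on_min)

text \<open>By the Leibniz formula the determinant is a polynomial in the entries; permutations keep
  the indices below \<open>n\<close>.\<close>

lemma continuous_on_det:
  fixes M :: "'a::topological_space \<Rightarrow> 'b::{comm_ring_1, real_normed_algebra} mat"
  assumes "\<And>x. M x \<in> carrier_mat n n"
    and "\<And>i j. i < n \<Longrightarrow> j < n \<Longrightarrow> continuous_on S (\<lambda>x. M x $$ (i, j))"
  shows "continuous_on S (\<lambda>x. det (M x))"
  unfolding det_def'[OF assms(1)]
  by (intro continuous_intros assms(2)) (auto simp: permutes_in_image)

lemma continuous_on_adj_mat:
  fixes M :: "'a::topological_space \<Rightarrow> 'b::{comm_ring_1, real_normed_algebra} mat"
  assumes M: "\<And>x. M x \<in> carrier_mat n n"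
    and cont: "\<And>i j. i < n \<Longrightarrow> j < n \<Longrightarrow> continuous_on S (\<lambda>x. M x $$ (i, j))"
    and ij: "i < n" "j < n"
  shows "continuous_on S (\<lambda>x. adj_mat (M x) $$ (i, j))"
proof -
  have *: "adj_mat (M x) $$ (i, j) = (-1) ^ (j + i) * det (mat_delete (M x) j i)" for x
    using M[of x] ij by (simp add: adj_mat_def cofactor_def)
  have "continuous_on S (\<lambda>x. det (mat_delete (M x) j i))"
  proof (rule continuous_on_det)
    show "mat_delete (M x) j i \<in> carrier_mat (n - 1) (n - 1)" for x
      using mat_delete_carrier[OF M] .
    fix a b assume "a < n - 1" "b < n - 1"
    then show "continuous_on S (\<lambda>x. mat_delete (M x) j i $$ (a, b))"
      using carrier_matD[OF M] by (auto simp: mat_delete_def intro!: cont)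
  qed
  then show ?thesis unfolding * by (intro continuous_intros)
qed

lemma char_matrix_nth:
  assumes "A \<in> carrier_mat d d" "i < d" "j < d"
  shows "char_matrix A s $$ (i, j) = A $$ (i, j) - (if i = j then s else 0)"
  using assms by (simp add: char_matrix_def)

text \<open>The diagonal term is isolated so that the remaining sum has Metzler, hence nonnegative,
  coefficients when this is applied.\<close>

lemma char_matrix_solution_row:
  assumes A: "A \<in> carrier_mat d d" and v: "v \<in> carrier_vec d" and i: "i < d"
    and eq: "char_matrix A s *\<^sub>v v = - ones_vec d"
  shows "(s - A $$ (i, i)) * v $ i = 1 + (\<Sum>j\<in>{..<d} - {i}. A $$ (i, j) * v $ j)"
proof -
  have "-1 = (char_matrix A s *\<^sub>v v) $ i" using eq i by (simp add: ones_vec_def)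
  also have "\<dots> = (\<Sum>j<d. char_matrix A s $$ (i, j) * v $ j)"
    by (rule mult_mat_vec_nth[OF _ v i]) (use A in \<open>simp add: char_matrix_def\<close>)
  also have "\<dots> = (A $$ (i, i) - s) * v $ i + (\<Sum>j\<in>{..<d} - {i}. A $$ (i, j) * v $ j)"
    using i A by (subst sum.remove[of _ i]) (auto simp: char_matrix_nth)
  finally show ?thesis by (simp add: algebra_simps)
qed

text \<open>The solution of \<open>(A - s I) v = - e\<close> is positive for large \<open>s\<close>. Its smallest component
  depends continuously on \<open>s \<ge> 0\<close> and cannot vanish, so it stays positive down to \<open>s = 0\<close>.\<close>

lemma metzler_stable_solution_pos:
  assumes A: "A \<in> carrier_mat d d" "metzler A" and stable: "spectral_abscissa A < 0"
    and u: "u \<in> carrier_vec d" and Au: "A *\<^sub>v u = - ones_vec d" and k: "k < d"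
  shows "0 < u $ k"
proof -
  let ?B = "char_matrix A"
  have B: "?B s \<in> carrier_mat d d" for s using A by (simp add: char_matrix_def)
  have det: "det (?B s) \<noteq> 0" if "0 \<le> s" for s
    using that stable eigenvalue_le_spectral_abscissa[OF A(1), of s] eigenvalue_det[OF A(1), of s]
    by auto
  \<comment> \<open>Cramer's rule: this explicit form of the solution of
    \<open>(A - s I) v = - e\<close> makes its continuity in \<open>s\<close> visible.\<close>
  define v where "v s = (1 / det (?B s)) \<cdot>\<^sub>v (adj_mat (?B s) *\<^sub>v - ones_vec d)" for s
  have e: "- ones_vec d \<in> carrier_vec d" by (simp add: ones_vec_def)
  have v: "v s \<in> carrier_vec d" for s
    using adj_mat(1)[OF B, of s] by (simp add: v_def carrier_vecI)
  have adj_cancel: "(1 / det (?B s)) \<cdot>\<^sub>v ((det (?B s) \<cdot>\<^sub>m 1\<^sub>m d) *\<^sub>v w) = w"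
    if "0 \<le> s" "w \<in> carrier_vec d" for s w
    using that det[OF that(1)] by (simp add: smult_one_mult_mat_vec smult_smult_assoc)
  have solution: "?B s *\<^sub>v v s = - ones_vec d" if "0 \<le> s" for s
  proof -
    have "?B s *\<^sub>v v s = (1 / det (?B s)) \<cdot>\<^sub>v ((?B s * adj_mat (?B s)) *\<^sub>v - ones_vec d)"
      unfolding v_def using adj_mat(1)[OF B, of s] B[of s] e
      by (subst mult_mat_vec[of _ d d]) (auto simp: assoc_mult_mat_vec[of _ d d _ d])
    then show ?thesis using adj_cancel[OF that e] adj_mat(2)[OF B, of s] by simp
  qed
  have "?B 0 = A" using A by (intro eq_matI) (auto simp: char_matrix_def)
  \<comment> \<open>Writing \<open>- e\<close> as \<open>A u\<close>, the product of the adjugate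
    with \<open>A\<close> is \<open>det A\<close> times the identity and recovers
    \<open>u\<close>.\<close>
  then have v0: "v 0 = u"
    using adj_cancel[OF _ u, of 0] adj_mat(1,3)[OF B, of 0] A u Au
    by (simp add: v_def assoc_mult_mat_vec[of _ d d _ d, symmetric] flip: Au)
  define f where "f s = Min ((\<lambda>i. v s $ i) ` {..<d})" for s
  have f_in: "f s \<in> (\<lambda>i. v s $ i) ` {..<d}" for s
    unfolding f_def using k by (intro Min_in) auto
  have f_le: "f s \<le> v s $ j" if "j < d" for s j
    unfolding f_def using that by (intro Min_le) auto
  have cont: "continuous_on {0..} (\<lambda>s. v s $ i)" if i: "i < d" for i
  proof -
    have entries: "continuous_on {0..} (\<lambda>s. ?B s $$ (a, b))" if "a < d" "b < d" for a b
      using that A(1) by (cases "a = b") (auto simp: char_matrix_nth intro!: continuous_intros)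
    have "v s $ i = (1 / det (?B s)) * (\<Sum>j<d. adj_mat (?B s) $$ (i, j) * (- 1))" for s
      using mult_mat_vec_nth[OF adj_mat(1)[OF B] e i, of s] i adj_mat(1)[OF B, of s]
      by (simp add: v_def ones_vec_def sum_negf del: index_mult_mat_vec)
    then show ?thesis
      using det i by (auto intro!: continuous_intros continuous_on_det[OF B entries]
          continuous_on_adj_mat[OF B entries])
  qed
  \<comment> \<open>If the smallest component were zero, all components would be nonnegative, and
    its row would read \<open>0 = 1 +\<close> a nonnegative sum.\<close>
  have nonzero: "f s \<noteq> 0" if s: "0 \<le> s" for s
  proof
    assume 0: "f s = 0"
    then obtain i where i: "i < d" "v s $ i = 0" using f_in[of s] by auto
    have "0 \<le> (\<Sum>j\<in>{..<d} - {i}. A $$ (i, j) * v s $ j)"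
      using A i f_le[of _ s] 0 by (intro sum_nonneg mult_nonneg_nonneg) (auto simp: metzler_def)
    then show False using char_matrix_solution_row[OF A(1) v i(1) solution[OF s]] i(2) by simp
  qed
  \<comment> \<open>\<open>R\<close> dominates every row sum of \<open>A\<close>. In the row of the
    smallest component this yields \<open>1 <= (R - row sum) * f R\<close> with a nonnegative first
    factor, which forces \<open>f R > 0\<close>.\<close>
  define R where "R = (\<Sum>i<d. \<bar>\<Sum>j<d. A $$ (i, j)\<bar>)"
  have R: "0 \<le> R" unfolding R_def by (intro sum_nonneg) auto
  have fR: "0 < f R"
  proof -
    obtain i where i: "i < d" "v R $ i = f R" using f_in[of R] by auto
    have "f R * (\<Sum>j\<in>{..<d} - {i}. A $$ (i, j)) \<le> (\<Sum>j\<in>{..<d} - {i}. A $$ (i, j) * v R $ j)"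
      unfolding sum_distrib_left using A i f_le[of _ R]
      by (intro sum_mono) (auto simp: metzler_def mult.commute[of "f R"] intro!: mult_left_mono)
    then have "(R - A $$ (i, i)) * f R \<ge> 1 + f R * (\<Sum>j\<in>{..<d} - {i}. A $$ (i, j))"
      using char_matrix_solution_row[OF A(1) v i(1) solution[OF R]] i(2) by simp
    then have "1 \<le> (R - (\<Sum>j<d. A $$ (i, j))) * f R"
      using i(1) by (simp add: sum.remove[of "{..<d}" i "\<lambda>j. A $$ (i, j)"] algebra_simps)
    moreover have "\<bar>\<Sum>j<d. A $$ (i, j)\<bar> \<le> R"
      unfolding R_def using i(1) by (intro member_le_sum) auto
    ultimately show ?thesis
      by (smt (verit) zero_less_mult_iff)
  qed
  \<comment> \<open>Otherwise the intermediate value theorem on \<open>[0, R]\<close> would produce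
    a zero of \<open>f\<close>.\<close>
  have "0 < f 0"
  proof (rule ccontr)
    assume "\<not> 0 < f 0"
    moreover have "continuous_on {0..R} f"
      using continuous_on_subset[OF continuous_on_Min_image[of "{..<d}" "{0..}" "\<lambda>i s. v s $ i"],
          of "{0..R}"] cont k unfolding f_def by auto
    ultimately obtain s where "0 \<le> s" "f s = 0"
      using IVT'[of f 0 0 R] R fR by auto
    then show False using nonzero by blast
  qed
  then show ?thesis using f_le[OF k, of 0] v0 by simp
qed

section \<open>The candidate matrix and optimality\<close>

text \<open>Stability excludes the eigenvalue 0, so \<open>det A\<close> is nonzero and
  \<open>mat_inverse A\<close> is a \<open>Some\<close>; this justifies the \<open>the\<close> in
  \<open>neg_inv_ones\<close>.\<close>

lemma neg_inv_ones_solution: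
  assumes A: "A \<in> carrier_mat d d" and "spectral_abscissa A < 0"
  shows "neg_inv_ones d A \<in> carrier_vec d" "A *\<^sub>v neg_inv_ones d A = - ones_vec d"
proof -
  have "\<not> eigenvalue A 0" using eigenvalue_le_spectral_abscissa[OF A, of 0] assms(2) by auto
  moreover have "char_matrix A 0 = A" using A by (intro eq_matI) (auto simp: char_matrix_def)
  ultimately have "det A \<noteq> 0" using eigenvalue_det[OF A, of 0] by simp
  then have "A \<in> Units (ring_mat TYPE(real) d ())" by (rule det_non_zero_imp_unit[OF A])
  then obtain B where "mat_inverse A = Some B"
    using mat_inverse(1)[OF A, where b = "()"] by (cases "mat_inverse A") auto
  then have B: "neg_inv_ones d A = - (B *\<^sub>v ones_vec d)" "A * B = 1\<^sub>m d" "B \<in> carrier_mat d d"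
    using mat_inverse(2)[OF A] by (auto simp: neg_inv_ones_def)
  have o: "ones_vec d \<in> carrier_vec d" by (simp add: ones_vec_def)
  have w: "B *\<^sub>v ones_vec d \<in> carrier_vec d" by (rule mult_mat_vec_carrier[OF B(3) o])
  then show "neg_inv_ones d A \<in> carrier_vec d" unfolding B(1) by simp
  have "A *\<^sub>v (B *\<^sub>v ones_vec d) = ones_vec d"
    unfolding assoc_mult_mat_vec[OF A B(3) o, symmetric] B(2) by (rule one_mult_mat_vec[OF o])
  moreover have "A *\<^sub>v - (B *\<^sub>v ones_vec d) = - (A *\<^sub>v (B *\<^sub>v ones_vec d))"
  proof (rule eq_vecI)
    fix i assume "i < dim_vec (- (A *\<^sub>v (B *\<^sub>v ones_vec d)))"
    then show "(A *\<^sub>v - (B *\<^sub>v ones_vec d)) $ i = (- (A *\<^sub>v (B *\<^sub>v ones_vec d))) $ i"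
      using A B(3) by simp
  qed simp
  ultimately show "A *\<^sub>v neg_inv_ones d A = - ones_vec d" unfolding B(1) by simp
qed

text \<open>\<open>E_k u\<close> is \<open>u $ k\<close> times \<open>e\<close>, so the factor
  \<open>1 / u $ k\<close> exactly cancels \<open>A u = - e\<close>. Since this factor is positive,
  the sum stays Metzler and has the positive kernel vector \<open>u\<close>.\<close>

lemma add_ones_col_mat_feasible:
  assumes A: "A \<in> carrier_mat d d" "metzler A"
    and u: "u \<in> carrier_vec d" "\<And>j. j < d \<Longrightarrow> 0 < u $ j"
    and Au: "A *\<^sub>v u = - ones_vec d" and k: "k < d"
  shows "A + (1 / u $ k) \<cdot>\<^sub>m ones_col_mat d k \<in> feasible_set d"
proof -
  let ?X = "A + (1 / u $ k) \<cdot>\<^sub>m ones_col_mat d k"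
  have X: "?X \<in> carrier_mat d d" using A by (simp add: ones_col_mat_def)
  have nth: "?X $$ (i, j) = A $$ (i, j) + (if j = k then 1 / u $ k else 0)"
    if "i < d" "j < d" for i j
    using that A by (simp add: ones_col_mat_def)
  have "metzler ?X"
    using A(2) nth u(2)[OF k] unfolding metzler_def carrier_matD[OF X] carrier_matD[OF A(1)] by simp
  moreover have "?X *\<^sub>v u = 0\<^sub>v d"
  proof (rule eq_vecI)
    fix i assume "i < dim_vec (0\<^sub>v d :: real vec)"
    then have i: "i < d" by simp
    have "(?X *\<^sub>v u) $ i = (\<Sum>j<d. A $$ (i, j) * u $ j + (if j = k then 1 / u $ k * u $ j else 0))"
      unfolding mult_mat_vec_nth[OF X u(1) i]
      by (intro sum.cong) (auto simp: nth[OF i] algebra_simps)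
    also have "\<dots> = (A *\<^sub>v u) $ i + 1"
      using k u(2)[OF k] by (simp add: sum.distrib mult_mat_vec_nth[OF A(1) u(1) i])
    also have "\<dots> = 0" using Au i by (simp add: ones_vec_def)
    finally show "(?X *\<^sub>v u) $ i = 0\<^sub>v d $ i" using i by simp
  qed (use carrier_matD(1)[OF X] in simp)
  ultimately show ?thesis
    using metzler_positive_kernel_abscissa[OF X _ _ u] k X by (auto simp: feasible_set_def)
qed

lemma inf_norm_smult_ones_col_mat:
  assumes "k < d" "0 \<le> t"
  shows "inf_norm_mat (t \<cdot>\<^sub>m ones_col_mat d k) = t"
proof -
  have "(\<Sum>j<d. \<bar>(t \<cdot>\<^sub>m ones_col_mat d k) $$ (i, j)\<bar>) = t" if "i < d" for i
  proof -
    have "(\<Sum>j<d. \<bar>(t \<cdot>\<^sub>m ones_col_mat d k) $$ (i, j)\<bar>) = (\<Sum>j<d. if j = k then t else 0)"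
      using that assms(2) by (intro sum.cong) (auto simp: ones_col_mat_def)
    then show ?thesis using assms(1) by simp
  qed
  then have "(\<lambda>i. \<Sum>j<d. \<bar>(t \<cdot>\<^sub>m ones_col_mat d k) $$ (i, j)\<bar>) ` {..<d} = {t}"
    using assms(1) by (auto simp del: index_smult_mat)
  then show ?thesis by (simp add: inf_norm_mat_def ones_col_mat_def)
qed

theorem theorem9:
  fixes A :: "real mat" and d :: nat
  assumes "d > 0"
    and "A \<in> carrier_mat d d"
    and "metzler A"
    and "spectral_abscissa A < 0"
  shows "optimal_value d A = 1 / Max {neg_inv_ones d A $ i | i. i < d} \<and>
    (\<forall>k < d. neg_inv_ones d A $ k = Max {neg_inv_ones d A $ i | i. i < d} \<longrightarrow>
       is_optimal_solution d A (A + optimal_value d A \<cdot>\<^sub>m ones_col_mat d k))"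
proof -
  define u where "u = neg_inv_ones d A"
  define c where "c = Max {u $ i | i. i < d}"
  note u = neg_inv_ones_solution[OF assms(2,4), folded u_def]
  have pos: "0 < u $ j" if "j < d" for j
    using metzler_stable_solution_pos[OF assms(2-4) u that] .
  have fin: "finite {u $ i | i. i < d}" by simp
  have le: "u $ j \<le> c" if "j < d" for j
    unfolding c_def using that by (intro Max_ge[OF fin]) auto
  have "c \<in> {u $ i | i. i < d}"
    unfolding c_def using assms(1) by (intro Max_in[OF fin]) auto
  then obtain k0 where k0: "k0 < d" "u $ k0 = c" by auto
  have lower: "1 / c \<le> inf_norm_mat (Y - A)" if "Y \<in> feasible_set d" for Y
    using inf_norm_lower_bound[OF assms(2,3,1) u(1) pos le u(2) that] .
  \<comment> \<open>Stated for every maximizing index, since ties are possible; \<open>k0\<close>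
    serves only to show that the infimum is attained.\<close>
  have candidate: "A + (1 / c) \<cdot>\<^sub>m ones_col_mat d k \<in> feasible_set d"
      "inf_norm_mat (A + (1 / c) \<cdot>\<^sub>m ones_col_mat d k - A) = 1 / c"
    if k: "k < d" "u $ k = c" for k
  proof -
    show "A + (1 / c) \<cdot>\<^sub>m ones_col_mat d k \<in> feasible_set d"
      using add_ones_col_mat_feasible[OF assms(2,3) u(1) pos u(2) k(1)] k(2) by simp
    have "A + (1 / c) \<cdot>\<^sub>m ones_col_mat d k - A = (1 / c) \<cdot>\<^sub>m ones_col_mat d k"
      using assms(2) by (intro eq_matI) (auto simp: ones_col_mat_def)
    then show "inf_norm_mat (A + (1 / c) \<cdot>\<^sub>m ones_col_mat d k - A) = 1 / c"
      using inf_norm_smult_ones_col_mat[OF k(1), of "1 / c"] pos[OF k(1)] k(2) by simp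
  qed
  have opt: "optimal_value d A = 1 / c"
    unfolding optimal_value_def
  proof (rule cInf_eq_minimum)
    show "1 / c \<in> (\<lambda>X. inf_norm_mat (X - A)) ` feasible_set d"
      using candidate[OF k0] by (intro image_eqI[of _ _ "A + (1 / c) \<cdot>\<^sub>m ones_col_mat d k0"]) auto
  qed (use lower in auto)
  have "is_optimal_solution d A (A + optimal_value d A \<cdot>\<^sub>m ones_col_mat d k)"
    if "k < d" "u $ k = c" for k
    using candidate[OF that] lower by (simp add: is_optimal_solution_def opt)
  then show ?thesis using opt unfolding u_def c_def by blast
qed

end
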